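(* Let $X$ be a real Banach space, $C\subset X$ a bounded closed convex set, $(M,d)$ a metric space and $f\colon C\to M$ a uniformly continuous map. Then the following are equivalent: (i) the map $f$ is finitely dentable; (ii) there exists an equivalent norm $|||\cdot|||$ on $X$ such that $\lim_n d(f(x_n),f(y_n))=0$ whenever the sequences $(x_n),(y_n)\subset C$ are such that $$\lim_{n\to\infty}\left(2|||x_n|||^2+2|||y_n|||^2-|||x_n+y_n|||^2\right)=0.$$
   Context: An open half-space of $X$ is a set $\{x\in X: x^*(x)>a\}$ with $x^*\in X^*$, $a\in\mathbb R$; $\mathbb H$ is the set of all of them. A map $f\colon C\to M$ is dentable if for every nonempty bounded $A\subset C$ and $\varepsilon>0$ there is $H\in\mathbb H$ with $A\cap H\neq\emptyset$ and $\operatorname{diam}(f(A\cap H))<\varepsilon$. For a dentable map $f$ on a bounded closed convex set $C$, $D\subset C$ and $\varepsilon>0$, let $[D]'_\varepsilon=\{x\in D:\operatorname{diam}(f(D\cap H))>\varepsilon \text{ for all } H\in\mathbb H\text{ with }x\in H\}$; put $[C]^0_\varepsilon=C$ and $[C]^{n+1}_\varepsilon=[[C]^n_\varepsilon]'_\varepsilon$. The map $f$ is finitely dentable if it is dentable and for every $\varepsilon>0$ there is $n\in\mathbb N$ with $[C]^n_\varepsilon=\emptyset$. *)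

theory Defs
  imports "HOL-Analysis.Analysis"
begin

definition open_halfspaces :: "'a::real_normed_vector set set" where
  "open_halfspaces = {{x. \<phi> x > a} | (\<phi> :: 'a \<Rightarrow> real) (a :: real). bounded_linear \<phi>}"

(* The library's real-valued diameter is only meaningful on bounded sets; an unbounded set
   counts as having infinite diameter. *)

definition diam_less :: "'m::metric_space set \<Rightarrow> real \<Rightarrow> bool" where
  "diam_less S \<epsilon> \<longleftrightarrow> bounded S \<and> diameter S < \<epsilon>"

definition diam_greater :: "'m::metric_space set \<Rightarrow> real \<Rightarrow> bool" where
  "diam_greater S \<epsilon> \<longleftrightarrow> (bounded S \<longrightarrow> diameter S > \<epsilon>)"

definition dentable_map ::
  "'a::real_normed_vector set \<Rightarrow> ('a \<Rightarrow> 'm::metric_space) \<Rightarrow> bool" where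
  "dentable_map C f \<longleftrightarrow>
     (\<forall>A \<epsilon>. A \<subseteq> C \<and> A \<noteq> {} \<and> bounded A \<and> \<epsilon> > 0 \<longrightarrow>
        (\<exists>H\<in>open_halfspaces. A \<inter> H \<noteq> {} \<and> diam_less (f ` (A \<inter> H)) \<epsilon>))"

definition slice_derivation ::
  "('a::real_normed_vector \<Rightarrow> 'm::metric_space) \<Rightarrow> real \<Rightarrow> 'a set \<Rightarrow> 'a set" where
  "slice_derivation f \<epsilon> D =
     {x\<in>D. \<forall>H\<in>open_halfspaces. x \<in> H \<longrightarrow> diam_greater (f ` (D \<inter> H)) \<epsilon>}"

definition finitely_dentable_map ::
  "'a::real_normed_vector set \<Rightarrow> ('a \<Rightarrow> 'm::metric_space) \<Rightarrow> bool" where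
  "finitely_dentable_map C f \<longleftrightarrow>
     dentable_map C f \<and> (\<forall>\<epsilon>>0. \<exists>n. (slice_derivation f \<epsilon> ^^ n) C = {})"

definition equivalent_norm :: "('a::real_normed_vector \<Rightarrow> real) \<Rightarrow> bool" where
  "equivalent_norm N \<longleftrightarrow>
     (\<forall>x. N x = 0 \<longleftrightarrow> x = 0) \<and>
     (\<forall>x y. N (x + y) \<le> N x + N y) \<and>
     (\<forall>c x. N (c *\<^sub>R x) = \<bar>c\<bar> * N x) \<and>
     (\<exists>a>0. \<exists>b>0. \<forall>x. a * norm x \<le> N x \<and> N x \<le> b * norm x)"

end

theory Submission
  imports Defs
begin

text \<open>If the norm \<open>N\<close> satisfies (ii), a supporting functional at a point where \<open>N\<close> almost attains
  its supremum over \<open>D\<close> cuts off a slice on which the parallelogram gap, hence the oscillation of \<open>f\<close>,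
  is small; so every derivation lowers the supremum of \<open>N\<^sup>2\<close> by a fixed amount.

  Conversely, let \<open>D n\<close> be the iterated derivations of \<open>C\<close>. If \<open>x, y \<in> D n\<close> and \<open>f x\<close>, \<open>f y\<close> are more
  than \<open>2\<epsilon>\<close> apart, the segment from \<open>x\<close> to \<open>y\<close> meets \<open>D (Suc n)\<close> away from its endpoints. Hence one of
  the finitely many convex functions \<open>dist(\<cdot>, D n)\<close> has a midpoint gap bounded below over all pairs of
  points of \<open>C\<close> whose images are far apart. Minkowski functionals of sublevel sets turn such gaps into parallelogram gaps
  of seminorms, and a weighted \<open>\<ell>\<^sup>2\<close>-sum of countably many of them with the original norm is the
  required norm.\<close>

section \<open>Linear functionals supporting a sublinear functional\<close>

definition sublinear :: "('a::real_vector \<Rightarrow> real) \<Rightarrow> bool" where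
  "sublinear q \<longleftrightarrow> (\<forall>x y. q (x + y) \<le> q x + q y) \<and> (\<forall>c x. c \<ge> 0 \<longrightarrow> q (c *\<^sub>R x) = c * q x)"

lemma sublinear_add: "sublinear q \<Longrightarrow> q (x + y) \<le> q x + q y"
  and sublinear_scale: "sublinear q \<Longrightarrow> c \<ge> 0 \<Longrightarrow> q (c *\<^sub>R x) = c * q x"
  by (auto simp: sublinear_def)

lemma sublinear_zero: "sublinear q \<Longrightarrow> q 0 = 0"
  using sublinear_scale[of q 0 0] by simp

lemma sublinear_minus_ge: "sublinear q \<Longrightarrow> - q (- x) \<le> q x"
  using sublinear_add[of q x "- x"] sublinear_zero[of q] by simp

text \<open>Applying the scaling bound to \<open>inverse c\<close> and \<open>c *\<^sub>R x\<close>
  gives the reverse inequality, so an upper bound suffices.\<close>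

lemma sublinearI:
  assumes "\<And>x y. q (x + y) \<le> q x + q y" and "q 0 = 0"
    and "\<And>c x. c > 0 \<Longrightarrow> q (c *\<^sub>R x) \<le> c * q x"
  shows "sublinear q"
proof -
  have "q (c *\<^sub>R x) = c * q x" if "c > 0" for c x
  proof (rule antisym)
    have "q x \<le> inverse c * q (c *\<^sub>R x)"
      using assms(3)[of "inverse c" "c *\<^sub>R x"] that by simp
    then show "c * q x \<le> q (c *\<^sub>R x)"
      using that by (simp add: field_simps)
  qed (use assms(3) that in auto)
  then have "q (c *\<^sub>R x) = c * q x" if "c \<ge> 0" for c x
    using that assms(2) by (cases "c = 0") auto
  then show ?thesis
    using assms(1) by (auto simp: sublinear_def)
qed

text \<open>The infimum over \<open>t\<close> of the right-hand sides works. Taking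
  \<open>t = 0\<close> puts \<open>r\<close> below \<open>q\<close>, and \<open>t = 1\<close> at
  \<open>- y\<close> gives \<open>r (- y) \<le> - q y\<close>, so a linear functional below
  \<open>r\<close> is at least \<open>q y\<close> at \<open>y\<close>.\<close>

lemma sublinear_shift:
  fixes q :: "'a::real_vector \<Rightarrow> real"
  assumes q: "sublinear q"
  obtains r where "sublinear r" and "\<And>x t. t \<ge> 0 \<Longrightarrow> r x \<le> q (x + t *\<^sub>R y) - t * q y"
proof
  define r where "r x = (INF t\<in>{0..}. q (x + t *\<^sub>R y) - t * q y)" for x
  \<comment> \<open>Subadditivity bounds \<open>t * q y = q (t *\<^sub>R y)\<close>; this keeps the
    infimum finite.\<close>
  have lb: "- q (- x) \<le> q (x + t *\<^sub>R y) - t * q y" if "t \<ge> 0" for x t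
    using sublinear_add[OF q, of "x + t *\<^sub>R y" "- x"] sublinear_scale[OF q that, of y] by simp
  have bdd: "bdd_below ((\<lambda>t. q (x + t *\<^sub>R y) - t * q y) ` {0..})" for x
    by (rule bdd_belowI2[of _ "- q (- x)"]) (use lb in auto)
  show le: "r x \<le> q (x + t *\<^sub>R y) - t * q y" if "t \<ge> 0" for x t
    unfolding r_def by (rule cINF_lower[OF bdd]) (use that in auto)
  have ge: "c \<le> r x" if "\<And>t. t \<ge> 0 \<Longrightarrow> c \<le> q (x + t *\<^sub>R y) - t * q y" for c x
    unfolding r_def by (rule cINF_greatest) (use that in auto)
  show "sublinear r"
  proof (rule sublinearI)
    fix x z
    \<comment> \<open>Parameters \<open>t\<close> for \<open>x\<close> and \<open>s\<close> for
      \<open>z\<close> are merged into the parameter \<open>t + s\<close> for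
      \<open>x + z\<close>.\<close>
    have "r (x + z) - (q (z + s *\<^sub>R y) - s * q y) \<le> q (x + t *\<^sub>R y) - t * q y"
      if "s \<ge> 0" "t \<ge> 0" for s t
      using le[of "t + s" "x + z"] sublinear_add[OF q, of "x + t *\<^sub>R y" "z + s *\<^sub>R y"] that
      by (simp add: algebra_simps)
    then have "r (x + z) - (q (z + s *\<^sub>R y) - s * q y) \<le> r x" if "s \<ge> 0" for s
      using that by (intro ge) auto
    then have "r (x + z) - r x \<le> r z"
      by (intro ge) (simp add: algebra_simps)
    then show "r (x + z) \<le> r x + r z" by simp
  next
    have "0 \<le> r 0"
      by (rule ge) (simp add: sublinear_scale[OF q])
    moreover have "r 0 \<le> 0"
      using le[of 0 0] sublinear_zero[OF q] by simp
    ultimately show "r 0 = 0" by simp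
  next
    fix c :: real and x assume c: "c > 0"
    have "inverse c * r (c *\<^sub>R x) \<le> r x"
    proof (rule ge)
      fix t :: real assume t: "t \<ge> 0"
      have "r (c *\<^sub>R x) \<le> q (c *\<^sub>R x + (c * t) *\<^sub>R y) - (c * t) * q y"
        by (rule le) (use c t in auto)
      also have "\<dots> = c * (q (x + t *\<^sub>R y) - t * q y)"
        using sublinear_scale[OF q, of c "x + t *\<^sub>R y"] c by (simp add: algebra_simps)
      finally show "inverse c * r (c *\<^sub>R x) \<le> q (x + t *\<^sub>R y) - t * q y"
        using c by (simp add: field_simps)
    qed
    then show "r (c *\<^sub>R x) \<le> c * r x"
      using c by (simp add: field_simps)
  qed
qed

text \<open>By Zorn's lemma there is a pointwise minimal sublinear functional below \<open>p\<close>;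
  the construction of \<open>sublinear_shift\<close> cannot lower it, which forces additivity.\<close>

lemma sublinear_ge_linear:
  fixes p :: "'a::real_vector \<Rightarrow> real"
  assumes p: "sublinear p"
  obtains \<phi> where "linear \<phi>" and "\<And>x. \<phi> x \<le> p x"
proof -
  define S where "S = {q. sublinear q \<and> q \<le> p}"
  \<comment> \<open>Zorn's lemma is applied to the reversed order, so chains need lower bounds; the
    pointwise infimum is one.\<close>
  have "\<exists>m\<in>S. \<forall>a\<in>S. a \<le> m \<longrightarrow> a = m"
  proof (rule predicate_Zorn)
    show "partial_order_on S (relation_of (\<lambda>a b. b \<le> a) S)"
      by (rule partial_order_on_relation_ofI) auto
  next
    fix K assume K: "K \<in> Chains (relation_of (\<lambda>a b. b \<le> a) S)"
    have KS: "K \<subseteq> S" and chain: "\<And>a b. a \<in> K \<Longrightarrow> b \<in> K \<Longrightarrow> a \<le> b \<or> b \<le> a"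
      using K by (auto simp: Chains_def relation_of_def)
    show "\<exists>u\<in>S. \<forall>a\<in>K. u \<le> a"
    proof (cases "K = {}")
      case True
      then show ?thesis using p by (auto simp: S_def)
    next
      case False
      define u where "u x = (INF q\<in>K. q x)" for x
      have lb: "- p (- x) \<le> q x" if "q \<in> K" for q x
      proof -
        have "sublinear q" "q (- x) \<le> p (- x)"
          using that KS by (auto simp: S_def le_fun_def)
        then show ?thesis using sublinear_minus_ge[of q x] by linarith
      qed
      have bdd: "bdd_below ((\<lambda>q. q x) ` K)" for x
        by (rule bdd_belowI2[of _ "- p (- x)"]) (use lb in auto)
      have le: "u x \<le> q x" if "q \<in> K" for q x
        unfolding u_def by (rule cINF_lower[OF bdd that])
      have ge: "c \<le> u x" if "\<And>q. q \<in> K \<Longrightarrow> c \<le> q x" for c x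
        unfolding u_def by (rule cINF_greatest) (use that False in auto)
      have sub: "sublinear q" if "q \<in> K" for q
        using that KS by (auto simp: S_def)
      have "sublinear u"
      proof (rule sublinearI)
        fix x y
        \<comment> \<open>In a chain the smaller of \<open>q1\<close> and \<open>q2\<close> can be
          used for both arguments.\<close>
        have "u (x + y) - q2 y \<le> q1 x" if q12: "q1 \<in> K" "q2 \<in> K" for q1 q2
        proof -
          obtain q where "q \<in> K" "q \<le> q1" "q \<le> q2"
            using chain[OF q12] q12 by blast
          then show ?thesis
            using le[of q "x + y"] sublinear_add[OF sub, of q x y]
            by (auto simp: le_fun_def) (smt (verit))
        qed
        then have "u (x + y) - q y \<le> u x" if "q \<in> K" for q
          using that by (intro ge) auto
        then have "u (x + y) - u x \<le> u y"
          by (intro ge) (simp add: algebra_simps)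
        then show "u (x + y) \<le> u x + u y" by simp
      next
        obtain q where "q \<in> K" using False by blast
        moreover have "0 \<le> u 0"
          by (rule ge) (simp add: sublinear_zero[OF sub])
        ultimately show "u 0 = 0"
          using le[of q 0] sublinear_zero[OF sub] by fastforce
      next
        fix c :: real and x assume c: "c > 0"
        have "inverse c * u (c *\<^sub>R x) \<le> u x"
        proof (rule ge)
          fix q assume "q \<in> K"
          then show "inverse c * u (c *\<^sub>R x) \<le> q x"
            using le[of q "c *\<^sub>R x"] sublinear_scale[OF sub, of q c x] c
            by (simp add: field_simps)
        qed
        then show "u (c *\<^sub>R x) \<le> c * u x"
          using c by (simp add: field_simps)
      qed
      moreover have "u \<le> p"
      proof -
        obtain q where "q \<in> K" using False by blast
        then show ?thesis
          using le[of q] KS by (auto simp: S_def le_fun_def intro: order_trans)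
      qed
      ultimately show ?thesis
        using le by (auto simp: S_def le_fun_def)
    qed
  qed
  then obtain m where m: "sublinear m" "m \<le> p"
    and min: "\<And>q. sublinear q \<Longrightarrow> q \<le> m \<Longrightarrow> q = m"
    by (auto simp: S_def)
  have add: "m (x + y) = m x + m y" for x y
  proof -
    obtain r where r: "sublinear r" "\<And>x t. t \<ge> 0 \<Longrightarrow> r x \<le> m (x + t *\<^sub>R y) - t * m y"
      using sublinear_shift[OF m(1), of y] by metis
    \<comment> \<open>The case \<open>t = 0\<close> gives \<open>r \<le> m\<close>, so minimality
      applies; then \<open>t = 1\<close> reads \<open>m x \<le> m (x + y) - m y\<close>, the missing
      half of additivity.\<close>
    have "r = m"
      using r(2)[of 0] by (intro min[OF r(1)]) (auto simp: le_fun_def)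
    then show ?thesis
      using r(2)[of 1 x] sublinear_add[OF m(1), of x y] by simp
  qed
  have neg: "m (- x) = - m x" for x
    using add[of x "- x"] sublinear_zero[OF m(1)] by simp
  have scale: "m (c *\<^sub>R x) = c * m x" for c x
    using sublinear_scale[OF m(1), of c x] sublinear_scale[OF m(1), of "- c" x] neg[of "c *\<^sub>R x"]
    by (cases "c \<ge> 0") auto
  show ?thesis
    by (rule that[of m]) (use add scale m(2) in \<open>auto simp: linear_iff le_fun_def\<close>)
qed

text \<open>A linear functional below the shift of \<open>p\<close> along \<open>x\<^sub>0\<close>
  lies below \<open>p\<close>, and its value at \<open>- x\<^sub>0\<close> forces equality at
  \<open>x\<^sub>0\<close>.\<close>

theorem sublinear_supporting_linear:
  fixes p :: "'a::real_vector \<Rightarrow> real"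
  assumes p: "sublinear p"
  obtains \<phi> where "linear \<phi>" and "\<And>x. \<phi> x \<le> p x" and "\<phi> x\<^sub>0 = p x\<^sub>0"
proof -
  obtain r where r: "sublinear r" "\<And>x t. t \<ge> 0 \<Longrightarrow> r x \<le> p (x + t *\<^sub>R x\<^sub>0) - t * p x\<^sub>0"
    using sublinear_shift[OF p, of x\<^sub>0] by metis
  obtain \<phi> where \<phi>: "linear \<phi>" "\<And>x. \<phi> x \<le> r x"
    using sublinear_ge_linear[OF r(1)] by metis
  have le: "\<phi> x \<le> p x" for x
    using \<phi>(2)[of x] r(2)[of 0 x] by simp
  have "- \<phi> x\<^sub>0 \<le> - p x\<^sub>0"
    using \<phi>(2)[of "- x\<^sub>0"] r(2)[of 1 "- x\<^sub>0"] sublinear_zero[OF p] linear_neg[OF \<phi>(1), of x\<^sub>0] by simp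
  then show ?thesis
    using that[OF \<phi>(1) le] le[of x\<^sub>0] by simp
qed

section \<open>From a norm to finite dentability\<close>

text \<open>The quantity in condition (ii). For an inner product norm the parallelogram law makes it
  the square of \<open>N (x - y)\<close>.\<close>

definition parallelogram_gap :: "('a::real_vector \<Rightarrow> real) \<Rightarrow> 'a \<Rightarrow> 'a \<Rightarrow> real" where
  "parallelogram_gap N x y = 2 * (N x)\<^sup>2 + 2 * (N y)\<^sup>2 - (N (x + y))\<^sup>2"

lemma bounded_diameter_le:
  fixes S :: "'m::metric_space set"
  assumes "0 \<le> e" and le: "\<And>x y. x \<in> S \<Longrightarrow> y \<in> S \<Longrightarrow> dist x y \<le> e"
  shows "bounded S \<and> diameter S \<le> e"
proof
  show "bounded S"
    unfolding bounded_two_points using le by blast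
  show "diameter S \<le> e"
    using assms by (auto simp: diameter_def intro!: cSUP_least)
qed

lemma equivalent_norm_ge_zero: "equivalent_norm N \<Longrightarrow> 0 \<le> N x"
  unfolding equivalent_norm_def by (meson mult_nonneg_nonneg norm_ge_zero order_trans less_imp_le)

lemma equivalent_norm_supporting:
  fixes N :: "'a::real_normed_vector \<Rightarrow> real"
  assumes N: "equivalent_norm N"
  obtains \<phi> where "bounded_linear \<phi>" and "\<And>y. \<phi> y \<le> N y" and "\<phi> x = N x"
proof -
  obtain b where b: "\<And>x. N x \<le> b * norm x"
    using N unfolding equivalent_norm_def by metis
  have "sublinear N"
    using N by (auto simp: equivalent_norm_def sublinear_def)
  then obtain \<phi> where \<phi>: "linear \<phi>" "\<And>y. \<phi> y \<le> N y" "\<phi> x = N x"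
    using sublinear_supporting_linear[of N x] by metis
  have "norm (\<phi> y) \<le> norm y * b" for y
    using \<phi>(2)[of y] \<phi>(2)[of "- y"] b[of y] b[of "- y"] linear_neg[OF \<phi>(1), of y]
    by (simp add: mult.commute)
  then have "bounded_linear \<phi>"
    using \<phi>(1) by (intro bounded_linear_intro[of _ b]) (auto simp: linear_iff)
  then show ?thesis
    using that \<phi> by blast
qed

text \<open>With \<open>s\<^sup>2 = r - \<delta> / 4\<close> and \<open>\<phi>\<close> supporting
  \<open>N\<close> at \<open>x\<close>, points of the slice where \<open>\<phi> > s\<close> satisfy
  \<open>N (y + z) \<ge> \<phi> y + \<phi> z > 2 * s\<close>, so their gap is below
  \<open>4 * r - 4 * s\<^sup>2 = \<delta>\<close>.\<close>

lemma equivalent_norm_slice: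
  fixes N :: "'a::real_normed_vector \<Rightarrow> real"
  assumes N: "equivalent_norm N" and D: "\<And>y. y \<in> D \<Longrightarrow> (N y)\<^sup>2 \<le> r"
    and x: "(N x)\<^sup>2 > r - \<delta> / 4"
  obtains H where "H \<in> open_halfspaces" and "x \<in> H"
    and "\<And>y z. y \<in> D \<inter> H \<Longrightarrow> z \<in> D \<inter> H \<Longrightarrow> parallelogram_gap N y z < \<delta>"
\<comment> \<open>Here \<open>s\<close> would be the root of a negative number. The gap is at most
  \<open>4 * r < \<delta>\<close> on all of \<open>D\<close>, and the whole space is the half-space
  of the zero functional above \<open>-1\<close>.\<close>
proof (cases "r - \<delta> / 4 < 0")
  case True
  have "UNIV \<in> open_halfspaces"
    unfolding open_halfspaces_def
    by (auto intro!: exI[of _ "\<lambda>_. 0"] exI[of _ "-1"] bounded_linear_zero)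
  then show ?thesis
  proof (rule that)
    fix y z assume "y \<in> D \<inter> UNIV" "z \<in> D \<inter> UNIV"
    then have "(N y)\<^sup>2 \<le> r" "(N z)\<^sup>2 \<le> r" using D by auto
    moreover have "0 \<le> (N (y + z))\<^sup>2" by simp
    ultimately show "parallelogram_gap N y z < \<delta>"
      unfolding parallelogram_gap_def using True by linarith
  qed simp
next
  case False
  define s where "s = sqrt (r - \<delta> / 4)"
  have s: "s \<ge> 0" "s\<^sup>2 = r - \<delta> / 4" using False by (auto simp: s_def)
  obtain \<phi> where \<phi>: "bounded_linear \<phi>" "\<And>y. \<phi> y \<le> N y" "\<phi> x = N x"
    using equivalent_norm_supporting[OF N] by metis
  have "{y. \<phi> y > s} \<in> open_halfspaces"
    unfolding open_halfspaces_def using \<phi>(1) by blast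
  then show ?thesis
  proof (rule that)
    have "s < N x"
      using x s equivalent_norm_ge_zero[OF N, of x] by (metis power_less_imp_less_base)
    then show "x \<in> {y. \<phi> y > s}"
      using \<phi>(3) by simp
    fix y z assume yz: "y \<in> D \<inter> {y. \<phi> y > s}" "z \<in> D \<inter> {y. \<phi> y > s}"
    have "\<phi> (y + z) = \<phi> y + \<phi> z"
      using \<phi>(1) by (simp add: linear_simps)
    then have "2 * s < N (y + z)"
      using \<phi>(2)[of "y + z"] yz by simp
    then have "(2 * s)\<^sup>2 < (N (y + z))\<^sup>2"
      using s by (intro power_strict_mono) auto
    moreover have "(N y)\<^sup>2 \<le> r" "(N z)\<^sup>2 \<le> r" using D yz by auto
    ultimately show "parallelogram_gap N y z < \<delta>"
      unfolding parallelogram_gap_def using s by (simp add: power_mult_distrib)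
  qed
qed

lemma gap_modulus_imp_finitely_dentable:
  fixes C :: "'a::real_normed_vector set" and f :: "'a \<Rightarrow> 'm::metric_space"
  assumes C: "bounded C" and N: "equivalent_norm N"
    and modulus: "\<And>\<epsilon>. \<epsilon> > 0 \<Longrightarrow> \<exists>\<delta>>0. \<forall>x\<in>C. \<forall>y\<in>C. parallelogram_gap N x y < \<delta> \<longrightarrow> dist (f x) (f y) < \<epsilon>"
  shows "finitely_dentable_map C f"
proof -
  obtain R where R: "\<And>x. x \<in> C \<Longrightarrow> (N x)\<^sup>2 \<le> R"
  proof -
    obtain b where b: "b > 0" "\<And>x. N x \<le> b * norm x"
      using N by (auto simp: equivalent_norm_def)
    obtain B where B: "\<And>x. x \<in> C \<Longrightarrow> norm x \<le> B"
      using C by (auto simp: bounded_iff)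
    have "(N x)\<^sup>2 \<le> (b * B)\<^sup>2" if "x \<in> C" for x
      using order_trans[OF b(2)[of x] mult_left_mono[OF B[OF that], of b]] b(1)
        equivalent_norm_ge_zero[OF N, of x]
      by (intro power_mono) auto
    then show ?thesis by (rule that)
  qed
  \<comment> \<open>One estimate serves both claims: dentability takes \<open>r\<close> to be a
    supremum over \<open>A\<close>, the derivations take the level reached after \<open>n\<close>
    steps.\<close>
  have slice: "\<exists>H\<in>open_halfspaces. x \<in> H \<and> bounded (f ` (D \<inter> H)) \<and> diameter (f ` (D \<inter> H)) \<le> \<epsilon>"
    if "D \<subseteq> C" and r: "\<And>y. y \<in> D \<Longrightarrow> (N y)\<^sup>2 \<le> r" and x: "(N x)\<^sup>2 > r - \<delta> / 4" and "\<epsilon> > 0"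
      and \<delta>: "\<forall>x\<in>C. \<forall>y\<in>C. parallelogram_gap N x y < \<delta> \<longrightarrow> dist (f x) (f y) < \<epsilon>"
    for D x r \<delta> \<epsilon>
  proof -
    obtain H where H: "H \<in> open_halfspaces" "x \<in> H"
      "\<And>y z. y \<in> D \<inter> H \<Longrightarrow> z \<in> D \<inter> H \<Longrightarrow> parallelogram_gap N y z < \<delta>"
      using equivalent_norm_slice[OF N r x] by metis
    have "bounded (f ` (D \<inter> H)) \<and> diameter (f ` (D \<inter> H)) \<le> \<epsilon>"
      using H(3) \<delta> \<open>D \<subseteq> C\<close> \<open>\<epsilon> > 0\<close> by (intro bounded_diameter_le) (blast intro: less_imp_le)+
    then show ?thesis using H by blast
  qed
  have "dentable_map C f"
    unfolding dentable_map_def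
  proof (intro allI impI, elim conjE)
    fix A and \<epsilon> :: real assume A: "A \<subseteq> C" "A \<noteq> {}" and \<epsilon>: "\<epsilon> > 0"
    \<comment> \<open>\<open>slice\<close> bounds the diameter only weakly, so
      \<open>\<epsilon> / 2\<close> is used to reach the strict bound in
      \<open>diam_less\<close>.\<close>
    obtain \<delta> where \<delta>: "\<delta> > 0"
      "\<forall>x\<in>C. \<forall>y\<in>C. parallelogram_gap N x y < \<delta> \<longrightarrow> dist (f x) (f y) < \<epsilon> / 2"
      using modulus[of "\<epsilon> / 2"] \<epsilon> by auto
    define r where "r = (SUP x\<in>A. (N x)\<^sup>2)"
    have bdd: "bdd_above ((\<lambda>x. (N x)\<^sup>2) ` A)"
      using R A by (intro bdd_aboveI2[of _ _ R]) auto
    have r: "(N y)\<^sup>2 \<le> r" if "y \<in> A" for y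
      unfolding r_def by (rule cSUP_upper[OF that bdd])
    obtain x where x: "x \<in> A" "r - \<delta> / 4 < (N x)\<^sup>2"
      using less_cSUP_iff[OF A(2) bdd, of "r - \<delta> / 4"] \<delta>(1) by (auto simp: r_def)
    obtain H where H: "H \<in> open_halfspaces" "x \<in> H" "bounded (f ` (A \<inter> H))"
      "diameter (f ` (A \<inter> H)) \<le> \<epsilon> / 2"
      using slice[OF A(1) r x(2) _ \<delta>(2)] \<epsilon> by auto
    show "\<exists>H\<in>open_halfspaces. A \<inter> H \<noteq> {} \<and> diam_less (f ` (A \<inter> H)) \<epsilon>"
      by (rule bexI[OF _ H(1)]) (use H x \<epsilon> in \<open>auto simp: diam_less_def\<close>)
  qed
  moreover have "\<exists>n. (slice_derivation f \<epsilon> ^^ n) C = {}" if \<epsilon>: "\<epsilon> > 0" for \<epsilon>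
  proof -
    obtain \<delta> where \<delta>: "\<delta> > 0"
      "\<forall>x\<in>C. \<forall>y\<in>C. parallelogram_gap N x y < \<delta> \<longrightarrow> dist (f x) (f y) < \<epsilon>"
      using modulus[OF \<epsilon>] by auto
    let ?D = "\<lambda>n. (slice_derivation f \<epsilon> ^^ n) C"
    have D: "?D n \<subseteq> C \<and> (\<forall>x\<in>?D n. (N x)\<^sup>2 \<le> R - real n * (\<delta> / 4))" for n
    proof (induction n)
      case 0
      then show ?case using R by auto
    next
      case (Suc n)
      have "(N x)\<^sup>2 \<le> R - real (Suc n) * (\<delta> / 4)" if x: "x \<in> ?D (Suc n)" for x
      proof (rule ccontr)
        assume "\<not> ?thesis"
        then have "(N x)\<^sup>2 > (R - real n * (\<delta> / 4)) - \<delta> / 4"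
          by (simp add: field_simps)
        then obtain H where "H \<in> open_halfspaces" "x \<in> H"
          "bounded (f ` (?D n \<inter> H))" "diameter (f ` (?D n \<inter> H)) \<le> \<epsilon>"
          using slice[of "?D n" "R - real n * (\<delta> / 4)" \<delta> x \<epsilon>] Suc \<epsilon> \<delta>(2) by blast
        then show False
          using x by (force simp: slice_derivation_def diam_greater_def)
      qed
      moreover have "?D (Suc n) \<subseteq> ?D n"
        by (auto simp: slice_derivation_def)
      ultimately show ?case using Suc by blast
    qed
    obtain n where n: "R < real n * (\<delta> / 4)"
      using reals_Archimedean3[of "\<delta> / 4"] \<delta>(1) by auto
    have "x \<notin> ?D n" for x
      using D[of n] n zero_le_power2[of "N x"] by (smt (verit))
    then show ?thesis by blast
  qed
  ultimately show ?thesis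
    by (simp add: finitely_dentable_map_def)
qed

text \<open>If no \<open>\<delta>\<close> works for \<open>\<epsilon>\<close>, the failures at
  \<open>inverse (real (Suc n))\<close> form sequences whose gaps tend to 0, being nonnegative,
  while the images stay \<open>\<epsilon>\<close> apart.\<close>

lemma sequential_gap_imp_modulus:
  fixes f :: "'a::real_vector \<Rightarrow> 'm::metric_space"
  assumes nonneg: "\<And>x y. 0 \<le> parallelogram_gap N x y"
    and seq: "\<And>x y :: nat \<Rightarrow> 'a. range x \<subseteq> C \<Longrightarrow> range y \<subseteq> C \<Longrightarrow>
      (\<lambda>n. parallelogram_gap N (x n) (y n)) \<longlonglongrightarrow> 0 \<Longrightarrow> (\<lambda>n. dist (f (x n)) (f (y n))) \<longlonglongrightarrow> 0"
    and "\<epsilon> > 0"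
  shows "\<exists>\<delta>>0. \<forall>x\<in>C. \<forall>y\<in>C. parallelogram_gap N x y < \<delta> \<longrightarrow> dist (f x) (f y) < \<epsilon>"
proof (rule ccontr)
  assume contra: "\<not> ?thesis"
  have "\<exists>x y. x \<in> C \<and> y \<in> C \<and> parallelogram_gap N x y < inverse (real (Suc n)) \<and> \<epsilon> \<le> dist (f x) (f y)"
    for n
    using contra by (meson not_less inverse_positive_iff_positive of_nat_0_less_iff zero_less_Suc)
  then obtain x y where xy: "\<And>n. x n \<in> C" "\<And>n. y n \<in> C"
    "\<And>n. parallelogram_gap N (x n) (y n) < inverse (real (Suc n))"
    "\<And>n. \<epsilon> \<le> dist (f (x n)) (f (y n))"
    by metis
  have "(\<lambda>n. parallelogram_gap N (x n) (y n)) \<longlonglongrightarrow> 0"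
    by (rule tendsto_sandwich[OF _ _ tendsto_const LIMSEQ_inverse_real_of_nat])
      (use nonneg xy(3) in \<open>auto intro!: always_eventually less_imp_le\<close>)
  then have "(\<lambda>n. dist (f (x n)) (f (y n))) \<longlonglongrightarrow> 0"
    using xy by (intro seq) auto
  then have "\<forall>\<^sub>F n in sequentially. dist (f (x n)) (f (y n)) < \<epsilon>"
    using \<open>\<epsilon> > 0\<close> by (rule order_tendstoD)
  then show False
    using xy(4) by (auto simp: eventually_sequentially not_less[symmetric])
qed

section \<open>Seminorms from convex functions\<close>

text \<open>The constant 1 lets a geometric series dominate sums of squares of such seminorms. Zeros
  off the origin are allowed, because Minkowski functionals of unbounded sets can have them.\<close>

definition contractive_seminorm :: "('a::real_normed_vector \<Rightarrow> real) \<Rightarrow> bool" where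
  "contractive_seminorm p \<longleftrightarrow>
     (\<forall>x y. p (x + y) \<le> p x + p y) \<and> (\<forall>c x. p (c *\<^sub>R x) = \<bar>c\<bar> * p x) \<and> (\<forall>x. p x \<le> norm x)"

lemma contractive_seminorm_add: "contractive_seminorm p \<Longrightarrow> p (x + y) \<le> p x + p y"
  and contractive_seminorm_scale: "contractive_seminorm p \<Longrightarrow> p (c *\<^sub>R x) = \<bar>c\<bar> * p x"
  and contractive_seminorm_le: "contractive_seminorm p \<Longrightarrow> p x \<le> norm x"
  by (auto simp: contractive_seminorm_def)

lemma contractive_seminorm_nonneg:
  assumes "contractive_seminorm p"
  shows "0 \<le> p x"
  using contractive_seminorm_add[OF assms, of x "- x"] contractive_seminorm_scale[OF assms, of "- 1" x]
    contractive_seminorm_scale[OF assms, of 0 0] by simp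

lemma parallelogram_gap_ge_zero:
  assumes "N (x + y) \<le> N x + N y" and "0 \<le> N (x + y)"
  shows "0 \<le> parallelogram_gap N x y"
proof -
  have "(N (x + y))\<^sup>2 \<le> (N x + N y)\<^sup>2"
    using assms by (rule power_mono)
  also have "\<dots> \<le> 2 * (N x)\<^sup>2 + 2 * (N y)\<^sup>2"
    using zero_le_power2[of "N x - N y"] by (simp add: power2_sum power2_diff)
  finally show ?thesis by (simp add: parallelogram_gap_def)
qed

lemma contractive_seminorm_gap_nonneg:
  "contractive_seminorm p \<Longrightarrow> 0 \<le> parallelogram_gap p x y"
  by (intro parallelogram_gap_ge_zero contractive_seminorm_add contractive_seminorm_nonneg)

text \<open>\<open>P\<close> is the \<open>\<ell>\<^sup>2\<close>-sum with weights
  \<open>(1/2) ^ Suc n\<close>, which add up to 1. The gap is linear in the squared seminorm, so the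
  gap of \<open>P\<close> is the weighted sum of nonnegative gaps and dominates each term.\<close>

lemma contractive_seminorm_combine:
  fixes p :: "nat \<Rightarrow> 'a::real_normed_vector \<Rightarrow> real"
  assumes p: "\<And>n. contractive_seminorm (p n)"
  obtains P where "contractive_seminorm P"
    and "\<And>n x. (1/2) ^ Suc n * (p n x)\<^sup>2 \<le> (P x)\<^sup>2"
    and "\<And>n x y. (1/2) ^ Suc n * parallelogram_gap (p n) x y \<le> parallelogram_gap P x y"
proof
  define w :: "nat \<Rightarrow> real" where "w n = (1/2) ^ Suc n" for n
  have w: "w n > 0" for n by (simp add: w_def)
  have w_sums: "w sums 1"
    using power_half_series by (simp add: w_def[abs_def])
  note nonneg = contractive_seminorm_nonneg[OF p]
  define P where "P x = sqrt (\<Sum>n. w n * (p n x)\<^sup>2)" for x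
  have le: "w n * (p n x)\<^sup>2 \<le> w n * (norm x)\<^sup>2" for n x
    using w nonneg contractive_seminorm_le[OF p] by (intro mult_left_mono power_mono) (auto intro: less_imp_le)
  have norm_sums: "(\<lambda>n. w n * (norm x)\<^sup>2) sums (norm x)\<^sup>2" for x
    using sums_mult2[OF w_sums, of "(norm x)\<^sup>2"] by simp
  have term_nonneg: "0 \<le> w n * (p n x)\<^sup>2" for n x
    using w[of n] by simp
  have summ: "summable (\<lambda>n. w n * (p n x)\<^sup>2)" for x
    by (rule summable_comparison_test'[OF sums_summable[OF norm_sums[of x]], of 0])
      (use le[of _ x] term_nonneg[of _ x] in auto)
  have pos: "0 \<le> (\<Sum>n. w n * (p n x)\<^sup>2)" for x
    by (rule suminf_nonneg[OF summ term_nonneg])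
  have P2: "(P x)\<^sup>2 = (\<Sum>n. w n * (p n x)\<^sup>2)" for x
    using pos[of x] by (simp add: P_def)
  show "(1/2) ^ Suc n * (p n x)\<^sup>2 \<le> (P x)\<^sup>2" for n x
    using sum_le_suminf[OF summ[of x], of "{n}"] w[THEN less_imp_le] by (simp add: P2 w_def)
  show "(1/2) ^ Suc n * parallelogram_gap (p n) x y \<le> parallelogram_gap P x y" for n x y
  proof -
    have "(\<lambda>n. w n * parallelogram_gap (p n) x y) = (\<lambda>n. 2 * (w n * (p n x)\<^sup>2) + 2 * (w n * (p n y)\<^sup>2)
        - w n * (p n (x + y))\<^sup>2)"
      by (simp add: parallelogram_gap_def algebra_simps)
    moreover have "\<dots> sums parallelogram_gap P x y"
      unfolding parallelogram_gap_def P2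
      by (intro sums_diff sums_add sums_mult summable_sums summ)
    ultimately have s: "(\<lambda>n. w n * parallelogram_gap (p n) x y) sums parallelogram_gap P x y"
      by simp
    have "sum (\<lambda>n. w n * parallelogram_gap (p n) x y) {n} \<le> (\<Sum>n. w n * parallelogram_gap (p n) x y)"
      by (rule sum_le_suminf[OF sums_summable[OF s]])
        (use w[THEN less_imp_le] contractive_seminorm_gap_nonneg[OF p] in auto)
    then show ?thesis
      using sums_unique[OF s] by (simp add: w_def)
  qed
  \<comment> \<open>The triangle inequality for \<open>P\<close> is the limit of Minkowski's
    inequality for the finite partial sums.\<close>
  have lim: "(\<lambda>n. L2_set (\<lambda>i. sqrt (w i) * p i x) {..<n}) \<longlonglongrightarrow> P x" for x
  proof -
    have "L2_set (\<lambda>i. sqrt (w i) * p i x) {..<n} = sqrt (\<Sum>i<n. w i * (p i x)\<^sup>2)" for n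
      using w[THEN less_imp_le] by (simp add: L2_set_def power_mult_distrib)
    then show ?thesis
      using tendsto_real_sqrt[OF summable_LIMSEQ[OF summ[of x]]] by (simp add: P_def)
  qed
  show "contractive_seminorm P"
    unfolding contractive_seminorm_def
  proof (intro conjI allI)
    fix x y
    have "L2_set (\<lambda>i. sqrt (w i) * p i (x + y)) {..<n}
        \<le> L2_set (\<lambda>i. sqrt (w i) * p i x) {..<n} + L2_set (\<lambda>i. sqrt (w i) * p i y) {..<n}" for n
    proof -
      have "L2_set (\<lambda>i. sqrt (w i) * p i (x + y)) {..<n}
          \<le> L2_set (\<lambda>i. sqrt (w i) * p i x + sqrt (w i) * p i y) {..<n}"
        unfolding distrib_left[symmetric]
        using w[THEN less_imp_le] nonneg
        by (intro L2_set_mono mult_left_mono contractive_seminorm_add[OF p]) auto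
      also have "\<dots> \<le> L2_set (\<lambda>i. sqrt (w i) * p i x) {..<n} + L2_set (\<lambda>i. sqrt (w i) * p i y) {..<n}"
        by (rule L2_set_triangle_ineq)
      finally show ?thesis .
    qed
    then show "P (x + y) \<le> P x + P y"
      by (intro LIMSEQ_le[OF lim tendsto_add[OF lim lim]]) auto
  next
    fix c :: real and x
    have "(\<Sum>n. w n * (p n (c *\<^sub>R x))\<^sup>2) = (\<Sum>n. c\<^sup>2 * (w n * (p n x)\<^sup>2))"
      by (simp add: contractive_seminorm_scale[OF p] power_mult_distrib mult_ac)
    also have "\<dots> = c\<^sup>2 * (\<Sum>n. w n * (p n x)\<^sup>2)"
      by (rule suminf_mult[OF summ])
    finally show "P (c *\<^sub>R x) = \<bar>c\<bar> * P x"
      by (simp add: P_def real_sqrt_mult)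
  next
    fix x
    have "(P x)\<^sup>2 \<le> (norm x)\<^sup>2"
      using suminf_le[OF le summ sums_summable[OF norm_sums], of x]
      unfolding P2 sums_unique[OF norm_sums[of x], symmetric] .
    then show "P x \<le> norm x"
      by (rule power2_le_imp_le) simp
  qed
qed

text \<open>This is the gauge of \<open>B\<close> multiplied by \<open>r\<close>: since
  \<open>B\<close> contains the ball of radius \<open>r\<close>, the factor makes it
  contractive.\<close>

lemma minkowski_functional:
  fixes B :: "'a::real_normed_vector set"
  assumes B: "convex B" and sym: "\<And>x. x \<in> B \<Longrightarrow> - x \<in> B" and r: "r > 0" "cball 0 r \<subseteq> B"
  obtains p where "contractive_seminorm p" and "\<And>x. x \<in> B \<Longrightarrow> p x \<le> r"
    and "\<And>x s. s > 0 \<Longrightarrow> p x < r * s \<Longrightarrow> inverse s *\<^sub>R x \<in> B"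
proof -
  define T where "T x = {s. s > 0 \<and> inverse s *\<^sub>R x \<in> B}" for x
  define q where "q x = Inf (T x)" for x
  have bdd: "bdd_below (T x)" for x
    by (rule bdd_belowI[of _ 0]) (auto simp: T_def)
  have B0: "0 \<in> B" using r by auto
  have T_norm: "s \<in> T x" if "s > 0" "norm x \<le> r * s" for x s
  proof -
    have "inverse s *\<^sub>R x \<in> cball 0 r"
      using that by (simp add: field_simps)
    then show ?thesis using r that by (auto simp: T_def)
  qed
  \<comment> \<open>Adding 1 keeps the scaling factor positive when \<open>x = 0\<close>.\<close>
  have ne: "T x \<noteq> {}" for x
    using T_norm[of "norm x / r + 1" x] r by (force simp: field_simps add_pos_nonneg)
  have q_le: "q x \<le> s" if "s \<in> T x" for x s
    unfolding q_def by (rule cInf_lower[OF that bdd])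
  have q_ge: "c \<le> q x" if "\<And>s. s \<in> T x \<Longrightarrow> c \<le> s" for c x
    unfolding q_def by (rule cInf_greatest[OF ne that])
  \<comment> \<open>\<open>T x\<close> is upward closed, because shrinking a point of the convex set
    \<open>B\<close> towards \<open>0 \<in> B\<close> stays in \<open>B\<close>.\<close>
  have q_less: "s \<in> T x" if less: "q x < s" for x s
  proof -
    obtain t where t: "t \<in> T x" "t < s"
      using cInf_lessD[OF ne less[unfolded q_def]] by blast
    then have "(t / s) *\<^sub>R (inverse t *\<^sub>R x) + (1 - t / s) *\<^sub>R 0 \<in> B"
      using B B0 by (intro convexD) (auto simp: T_def)
    then show ?thesis
      using t by (auto simp: T_def field_simps)
  qed
  have T_add: "s + t \<in> T (x + y)" if "s \<in> T x" "t \<in> T y" for s t x y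
  proof -
    have st: "s > 0" "t > 0" using that by (auto simp: T_def)
    have "(s / (s + t)) *\<^sub>R (inverse s *\<^sub>R x) + (t / (s + t)) *\<^sub>R (inverse t *\<^sub>R y) \<in> B"
      using B that by (intro convexD) (auto simp: T_def add_divide_distrib[symmetric])
    moreover have "(s / (s + t)) *\<^sub>R (inverse s *\<^sub>R x) + (t / (s + t)) *\<^sub>R (inverse t *\<^sub>R y)
        = inverse (s + t) *\<^sub>R (x + y)"
    proof -
      have "s / (s + t) * inverse s = inverse (s + t)" "t / (s + t) * inverse t = inverse (s + t)"
        using st by (simp_all add: field_simps)
      then show ?thesis by (simp add: scaleR_add_right)
    qed
    ultimately show ?thesis
      using st by (auto simp: T_def)
  qed
  have q_norm: "q x \<le> norm x / r" for x
  proof (rule dense_ge)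
    fix s assume s: "norm x / r < s"
    have "0 \<le> norm x / r" using r by simp
    with s have "0 < s" by linarith
    with s show "q x \<le> s"
      using r by (intro q_le T_norm) (auto simp: field_simps)
  qed
  have q0: "0 \<le> q x" for x
    by (rule q_ge) (auto simp: T_def)
  have "sublinear q"
  proof (rule sublinearI)
    fix x y
    have "q (x + y) - t \<le> q x" if "t \<in> T y" for t
      by (rule q_ge) (use q_le[OF T_add[OF _ that]] in \<open>auto simp: algebra_simps\<close>)
    then have "q (x + y) - q x \<le> q y"
      by (intro q_ge) (simp add: algebra_simps)
    then show "q (x + y) \<le> q x + q y" by simp
  next
    show "q 0 = 0"
      using q_norm[of 0] q0[of 0] by simp
  next
    fix c :: real and x assume c: "c > 0"
    have "inverse c * q (c *\<^sub>R x) \<le> q x"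
    proof (rule q_ge)
      fix s assume s: "s \<in> T x"
      then have "c * s \<in> T (c *\<^sub>R x)"
        using c by (auto simp: T_def field_simps)
      from q_le[OF this] show "inverse c * q (c *\<^sub>R x) \<le> s"
        using c by (simp add: field_simps)
    qed
    then show "q (c *\<^sub>R x) \<le> c * q x"
      using c by (simp add: field_simps)
  qed
  note q = this
  have "T (- x) = T x" for x
    using sym by (force simp: T_def)
  then have q_minus: "q (- x) = q x" for x
    by (simp add: q_def)
  have q_scale: "q (c *\<^sub>R x) = \<bar>c\<bar> * q x" for c x
    using sublinear_scale[OF q, of c x] sublinear_scale[OF q, of "- c" x] q_minus[of "c *\<^sub>R x"]
    by (cases "c \<ge> 0") auto
  show ?thesis
  proof (rule that[of "\<lambda>x. r * q x"])
    show "contractive_seminorm (\<lambda>x. r * q x)"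
      unfolding contractive_seminorm_def
    proof (intro conjI allI)
      show "r * q (x + y) \<le> r * q x + r * q y" for x y
        using mult_left_mono[OF sublinear_add[OF q, of x y], of r] r by (simp add: distrib_left)
      show "r * q (c *\<^sub>R x) = \<bar>c\<bar> * (r * q x)" for c x
        by (simp add: q_scale)
      show "r * q x \<le> norm x" for x
        using q_norm[of x] r by (simp add: field_simps)
    qed
  next
    fix x assume "x \<in> B"
    then have "q x \<le> 1" by (intro q_le) (simp add: T_def)
    then show "r * q x \<le> r" using r by simp
  next
    fix x and s :: real assume "s > 0" "r * q x < r * s"
    then show "inverse s *\<^sub>R x \<in> B"
      using q_less[of x s] r by (simp add: T_def)
  qed
qed

text \<open>If \<open>b \<ge> r\<close>, the excess of \<open>a\<close> over \<open>r\<close> beats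
  \<open>p \<le> 2 * r\<close> and yields the term \<open>4 * c\<close>. If \<open>b < r\<close>,
  then \<open>a - b \<ge> r * c\<close>, and the right-hand side is at least
  \<open>(a - b)\<^sup>2\<close>.\<close>

lemma square_gap_lower_bound:
  fixes a b p r c :: real
  assumes "r > 0" "c > 0" "0 \<le> p" "p \<le> 2 * r" "p \<le> a + b" "r * (1 + c) \<le> a" "0 \<le> b"
  shows "r\<^sup>2 * min (4 * c) (c\<^sup>2) \<le> 2 * a\<^sup>2 + 2 * b\<^sup>2 - p\<^sup>2"
proof (cases "b \<ge> r")
  case True
  have "(r * (1 + c))\<^sup>2 \<le> a\<^sup>2" "r\<^sup>2 \<le> b\<^sup>2" "p\<^sup>2 \<le> (2 * r)\<^sup>2"
    using assms True by (intro power_mono; auto)+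
  moreover have "(r * (1 + c))\<^sup>2 = r\<^sup>2 + r\<^sup>2 * (2 * c) + r\<^sup>2 * c\<^sup>2"
    by (simp add: power2_eq_square algebra_simps)
  moreover have "0 \<le> r\<^sup>2 * c\<^sup>2" by simp
  moreover have "(2 * r)\<^sup>2 = 4 * r\<^sup>2" by (simp add: power_mult_distrib)
  moreover have "r\<^sup>2 * min (4 * c) (c\<^sup>2) \<le> r\<^sup>2 * (4 * c)"
    by (intro mult_left_mono) auto
  ultimately show ?thesis by linarith
next
  case False
  have "r * c \<le> a - b"
    using assms False by (simp add: algebra_simps)
  then have "(r * c)\<^sup>2 \<le> (a - b)\<^sup>2" "p\<^sup>2 \<le> (a + b)\<^sup>2"
    using assms by (intro power_mono; simp)+
  moreover have "(a - b)\<^sup>2 + (a + b)\<^sup>2 = 2 * a\<^sup>2 + 2 * b\<^sup>2"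
    by (simp add: power2_sum power2_diff)
  moreover have "r\<^sup>2 * min (4 * c) (c\<^sup>2) \<le> r\<^sup>2 * c\<^sup>2"
    by (intro mult_left_mono) auto
  ultimately show ?thesis by (simp add: power_mult_distrib)
qed

lemma parallelogram_gap_commute: "parallelogram_gap N x y = parallelogram_gap N y x"
  by (simp add: parallelogram_gap_def add.commute)

text \<open>After symmetrising \<open>h\<close> to the even function \<open>g\<close>, a midpoint gap of \<open>g\<close> is detected by the
  Minkowski functional of one of finitely many sublevel sets of \<open>g\<close>.\<close>

lemma convex_gap_seminorm:
  fixes h :: "'a::real_normed_vector \<Rightarrow> real"
  assumes h: "convex_on UNIV h" and lip: "\<And>x y. \<bar>h x - h y\<bar> \<le> norm (x - y)"
    and \<delta>: "\<delta> > 0" and R: "R > 0"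
  obtains P \<eta> where "contractive_seminorm P" and "\<eta> > 0"
    and "\<And>x y. norm x \<le> R \<Longrightarrow> norm y \<le> R \<Longrightarrow> \<delta> \<le> h x / 2 + h y / 2 - h (midpoint x y) \<Longrightarrow>
      \<eta> \<le> parallelogram_gap P x y"
proof -
  define g where "g x = h x + h (- x)" for x
  have h_comb: "h (u *\<^sub>R x + v *\<^sub>R y) \<le> u * h x + v * h y" if "u \<ge> 0" "v \<ge> 0" "u + v = 1" for u v x y
    using h that by (auto simp: convex_on_def)
  have h_mid: "h (midpoint x y) \<le> h x / 2 + h y / 2" for x y
    using h_comb[of "1/2" "1/2" x y] by (simp add: midpoint_def scaleR_add_right inverse_eq_divide)
  have g_comb: "g (u *\<^sub>R x + v *\<^sub>R y) \<le> u * g x + v * g y" if "u \<ge> 0" "v \<ge> 0" "u + v = 1" for u v x y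
    using h_comb[OF that, of x y] h_comb[OF that, of "- x" "- y"] by (simp add: g_def algebra_simps)
  have g_even: "g (- x) = g x" for x by (simp add: g_def)
  have g_lip: "\<bar>g x - g y\<bar> \<le> 2 * norm (x - y)" for x y
    using lip[of x y] lip[of "- x" "- y"] norm_minus_commute[of x y] by (simp add: g_def)
  have g0: "g 0 \<le> g x" for x
    using h_mid[of x "- x"] by (simp add: g_def midpoint_def)
  \<comment> \<open>As \<open>g\<close> is 2-Lipschitz, it rises by at most
    \<open>\<delta> / 4\<close> on the ball of radius \<open>r\<close>, which therefore lies in
    every \<open>B j\<close>.\<close>
  define r where "r = \<delta> / 8"
  have r: "r > 0" using \<delta> by (simp add: r_def)
  define B where "B j = {x. g x \<le> g 0 + (real j + 1) * (\<delta> / 4)}" for j :: nat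
  have B_sym: "- x \<in> B j" if "x \<in> B j" for x j
    using that by (simp add: B_def g_even)
  have "\<exists>p. contractive_seminorm p \<and> (\<forall>x\<in>B j. p x \<le> r) \<and>
      (\<forall>x s. s > 0 \<and> p x < r * s \<longrightarrow> inverse s *\<^sub>R x \<in> B j)" for j
  proof -
    have "convex (B j)"
    proof (rule convexI)
      fix x y u v assume *: "x \<in> B j" "y \<in> B j" "0 \<le> u" "0 \<le> v" "u + v = (1::real)"
      have "u * g x + v * g y \<le> g 0 + (real j + 1) * (\<delta> / 4)"
        using * by (intro convex_bound_le) (auto simp: B_def)
      with g_comb[OF *(3-5), of x y] show "u *\<^sub>R x + v *\<^sub>R y \<in> B j"
        by (simp add: B_def)
    qed
    moreover have "cball 0 r \<subseteq> B j"
    proof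
      fix x :: 'a assume "x \<in> cball 0 r"
      then have "g x \<le> g 0 + \<delta> / 4"
        using g_lip[of x 0] by (simp add: r_def)
      also have "\<dots> \<le> g 0 + (real j + 1) * (\<delta> / 4)"
        using \<delta> by (simp add: field_simps)
      finally show "x \<in> B j" by (simp add: B_def)
    qed
    ultimately obtain p where "contractive_seminorm p" "\<And>x. x \<in> B j \<Longrightarrow> p x \<le> r"
      "\<And>x s. s > 0 \<Longrightarrow> p x < r * s \<Longrightarrow> inverse s *\<^sub>R x \<in> B j"
      using minkowski_functional[of "B j" r] r B_sym by blast
    then show ?thesis by blast
  qed
  then have "\<exists>p. \<forall>j. contractive_seminorm (p j) \<and> (\<forall>x\<in>B j. p j x \<le> r) \<and>
      (\<forall>x s. s > 0 \<and> p j x < r * s \<longrightarrow> inverse s *\<^sub>R x \<in> B j)"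
    by (intro choice allI)
  then obtain p where p: "\<And>j. contractive_seminorm (p j)" "\<And>j x. x \<in> B j \<Longrightarrow> p j x \<le> r"
    "\<And>j x s. s > 0 \<Longrightarrow> p j x < r * s \<Longrightarrow> inverse s *\<^sub>R x \<in> B j"
    by blast
  obtain P where P: "contractive_seminorm P"
    "\<And>n x y. (1/2) ^ Suc n * parallelogram_gap (p n) x y \<le> parallelogram_gap P x y"
    by (rule contractive_seminorm_combine[of p, OF p(1)]) blast
  \<comment> \<open>Dividing a point of norm at most \<open>R\<close> by \<open>1 + c\<close> moves
    it by at most \<open>c * R\<close>, so \<open>g\<close> changes by at most
    \<open>\<delta> / 2\<close>.\<close>
  define c where "c = \<delta> / (4 * R)"
  have c: "c > 0" using \<delta> R by (simp add: c_def)
  \<comment> \<open>\<open>g\<close> exceeds its minimum \<open>g 0\<close> by at most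
    \<open>2 * R\<close> on the ball of radius \<open>R\<close>, so with spacing
    \<open>\<delta> / 4\<close> only levels up to \<open>K\<close> occur.\<close>
  define K where "K = nat \<lceil>8 * R / \<delta>\<rceil>"
  define \<kappa> where "\<kappa> = r\<^sup>2 * min (4 * c) (c\<^sup>2)"
  have \<kappa>: "\<kappa> > 0" using r c by (simp add: \<kappa>_def)
  have far: "r * (1 + c) \<le> p j x"
    if "norm x \<le> R" "g x \<ge> g 0 + (real j + 1) * (\<delta> / 4) + 3 * \<delta> / 4" for j x
  proof (rule ccontr)
    assume "\<not> ?thesis"
    then have "inverse (1 + c) *\<^sub>R x \<in> B j"
      using p(3)[of "1 + c" j x] c by simp
    moreover have "norm (x - inverse (1 + c) *\<^sub>R x) \<le> c * R"
    proof -
      have "c / (1 + c) = 1 - inverse (1 + c)"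
        using c by (simp add: field_simps)
      then have "x - inverse (1 + c) *\<^sub>R x = (c / (1 + c)) *\<^sub>R x"
        by (simp add: scaleR_left_diff_distrib)
      also have "norm \<dots> = (c / (1 + c)) * norm x"
        using c by simp
      also have "\<dots> \<le> c * R"
        using c that(1) by (intro mult_mono) (auto simp: field_simps)
      finally show ?thesis .
    qed
    then have "2 * norm (x - inverse (1 + c) *\<^sub>R x) \<le> \<delta> / 2"
      using R by (simp add: c_def)
    ultimately show False
      using g_lip[of x "inverse (1 + c) *\<^sub>R x"] that(2) \<delta> by (simp add: B_def)
  qed
  show ?thesis
  proof (rule that[OF P(1)])
    show "0 < (1/2) ^ Suc K * \<kappa>" using \<kappa> by simp
    have main: "(1/2) ^ Suc K * \<kappa> \<le> parallelogram_gap P x y"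
      if xy: "norm x \<le> R" "norm y \<le> R" and gap: "\<delta> \<le> g x - g (midpoint x y)" for x y
    proof -
      define m where "m = midpoint x y"
      \<comment> \<open>The level just above the midpoint: \<open>m \<in> B j\<close>, while
        \<open>g x \<ge> g m + \<delta>\<close> places \<open>x\<close> at least
        \<open>3 * \<delta> / 4\<close> above the threshold of \<open>B j\<close>, as
        \<open>far\<close> requires.\<close>
      define j where "j = nat \<lfloor>(g m - g 0) / (\<delta> / 4)\<rfloor>"
      have "0 \<le> (g m - g 0) / (\<delta> / 4)" using g0[of m] \<delta> by simp
      then have j: "real j \<le> (g m - g 0) / (\<delta> / 4)" "(g m - g 0) / (\<delta> / 4) < real j + 1"
        unfolding j_def by linarith+
      then have j': "real j * (\<delta> / 4) \<le> g m - g 0" "g m - g 0 < (real j + 1) * (\<delta> / 4)"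
        using \<delta> by (simp_all add: field_simps)
      have "norm m \<le> R"
        using xy norm_triangle_ineq[of x y] by (simp add: m_def midpoint_def)
      then have "g m - g 0 \<le> 2 * R"
        using g_lip[of m 0] by simp
      then have "(g m - g 0) / (\<delta> / 4) \<le> 8 * R / \<delta>"
        using divide_right_mono[of "g m - g 0" "2 * R" "\<delta> / 4"] \<delta> by simp
      then have "j \<le> K"
        unfolding j_def K_def by linarith
      have "m \<in> B j"
        using j' by (simp add: B_def)
      then have "p j m \<le> r" by (rule p(2))
      moreover have "p j (x + y) = 2 * p j m"
      proof -
        have "x + y = 2 *\<^sub>R m" by (simp add: m_def midpoint_def)
        then show ?thesis using contractive_seminorm_scale[OF p(1), of j 2 m] by simp
      qed
      moreover have "r * (1 + c) \<le> p j x"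
        using xy(1) by (rule far) (use j' gap \<delta> in \<open>simp add: m_def[symmetric] field_simps\<close>)
      ultimately have "\<kappa> \<le> parallelogram_gap (p j) x y"
        unfolding \<kappa>_def parallelogram_gap_def
        using contractive_seminorm_add[OF p(1), of j x y]
        by (intro square_gap_lower_bound r c contractive_seminorm_nonneg[OF p(1)]) simp_all
      moreover have "(1/2 :: real) ^ Suc K \<le> (1/2) ^ Suc j"
        using \<open>j \<le> K\<close> by (intro power_decreasing) auto
      ultimately have "(1/2) ^ Suc K * \<kappa> \<le> (1/2) ^ Suc j * parallelogram_gap (p j) x y"
        using \<kappa> by (intro mult_mono) auto
      also have "\<dots> \<le> parallelogram_gap P x y" by (rule P(2))
      finally show ?thesis .
    qed
    fix x y assume xy: "norm x \<le> R" "norm y \<le> R" and gap: "\<delta> \<le> h x / 2 + h y / 2 - h (midpoint x y)"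
    \<comment> \<open>Convexity makes the midpoint gap of \<open>h\<close> at the reflected points
      nonnegative, so \<open>g\<close> inherits the gap. One of the two differences averaged in it
      is then at least \<open>\<delta>\<close>.\<close>
    have "midpoint (- x) (- y) = - midpoint x y"
      by (simp add: midpoint_def scaleR_diff_right scaleR_add_right)
    then have "h (- midpoint x y) \<le> h (- x) / 2 + h (- y) / 2"
      using h_mid[of "- x" "- y"] by simp
    then have "\<delta> \<le> g x / 2 + g y / 2 - g (midpoint x y)"
      using gap unfolding g_def by (simp add: field_simps)
    then consider "\<delta> \<le> g x - g (midpoint x y)" | "\<delta> \<le> g y - g (midpoint y x)"
      by (fastforce simp: midpoint_sym)
    then show "(1/2) ^ Suc K * \<kappa> \<le> parallelogram_gap P x y"
      using main[OF xy] main[OF xy(2,1)] parallelogram_gap_commute[of P x y] by cases auto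
  qed
qed

section \<open>Convexity of the distance to a convex set\<close>

lemma infdist_less_dist:
  assumes "infdist x A < r" and "A \<noteq> {}"
  obtains a where "a \<in> A" and "dist x a < r"
  using assms by (auto simp: infdist_notempty cINF_less_iff)

lemma dist_scaleR_scaleR: "dist (c *\<^sub>R x) (c *\<^sub>R y) = \<bar>c\<bar> * dist x (y :: 'a::real_normed_vector)"
  by (simp add: dist_norm scaleR_diff_right[symmetric] del: scaleR_diff_right)

lemma convex_on_infdist:
  fixes A :: "'a::real_normed_vector set"
  assumes A: "convex A" "A \<noteq> {}"
  shows "convex_on UNIV (\<lambda>x. infdist x A)"
  unfolding convex_on_def
proof (intro conjI ballI allI impI)
  fix x y :: 'a and u v :: real assume uv: "0 \<le> u" "0 \<le> v" "u + v = 1"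
  show "infdist (u *\<^sub>R x + v *\<^sub>R y) A \<le> u * infdist x A + v * infdist y A"
  proof (rule field_le_epsilon)
    fix e :: real assume e: "e > 0"
    obtain a where a: "a \<in> A" "dist x a < infdist x A + e"
      using infdist_less_dist[of x A "infdist x A + e"] A e by auto
    obtain b where b: "b \<in> A" "dist y b < infdist y A + e"
      using infdist_less_dist[of y A "infdist y A + e"] A e by auto
    have "u *\<^sub>R a + v *\<^sub>R b \<in> A"
      using A(1) a(1) b(1) uv by (rule convexD)
    then have "infdist (u *\<^sub>R x + v *\<^sub>R y) A \<le> dist (u *\<^sub>R x + v *\<^sub>R y) (u *\<^sub>R a + v *\<^sub>R b)"
      by (rule infdist_le)
    also have "\<dots> \<le> dist (u *\<^sub>R x) (u *\<^sub>R a) + dist (v *\<^sub>R y) (v *\<^sub>R b)"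
      by (rule dist_triangle_add)
    also have "\<dots> = u * dist x a + v * dist y b"
      using uv by (simp add: dist_scaleR_scaleR)
    also have "\<dots> \<le> u * (infdist x A + e) + v * (infdist y A + e)"
      using a b uv by (intro add_mono mult_left_mono) auto
    also have "\<dots> = u * infdist x A + v * infdist y A + (u + v) * e"
      by (simp add: algebra_simps)
    finally show "infdist (u *\<^sub>R x + v *\<^sub>R y) A \<le> u * infdist x A + v * infdist y A + e"
      using uv by simp
  qed
qed simp

section \<open>From finite dentability to a norm\<close>

text \<open>The derivation removes whole open half-spaces, namely those cutting slices of small
  image, and the complement of an open half-space is convex.\<close>

lemma convex_slice_derivation:
  fixes D :: "'a::real_normed_vector set"
  assumes "convex D"
  shows "convex (slice_derivation f \<epsilon> D)"
proof -
  have "slice_derivation f \<epsilon> D =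
      D \<inter> \<Inter> (uminus ` {H \<in> open_halfspaces. \<not> diam_greater (f ` (D \<inter> H)) \<epsilon>})"
    by (auto simp: slice_derivation_def)
  moreover have "convex (- H)" if "H \<in> open_halfspaces" for H :: "'a set"
  proof -
    obtain \<phi> :: "'a \<Rightarrow> real" and a where \<phi>: "bounded_linear \<phi>" and H: "H = {x. \<phi> x > a}"
      using \<open>H \<in> open_halfspaces\<close> by (auto simp: open_halfspaces_def)
    have "- H = \<phi> -` {..a}"
      by (auto simp: H)
    then show ?thesis
      using convex_linear_vimage[OF bounded_linear.linear[OF \<phi>], of "{..a}"] by simp
  qed
  ultimately show ?thesis
    using assms by (auto intro!: convex_Int convex_Inter)
qed

text \<open>The intermediate value theorem gives a point of the segment whose image is at half the
  distance from \<open>f x\<close> to \<open>f y\<close>, hence more than \<open>\<epsilon>\<close>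
  from both. A half-space containing that point contains \<open>x\<close> or \<open>y\<close>, so
  its slice has a large image.\<close>

lemma slice_derivation_segment:
  fixes f :: "'a::real_normed_vector \<Rightarrow> 'm::metric_space"
  assumes D: "convex D" "continuous_on D f" and xy: "x \<in> D" "y \<in> D"
    and far: "dist (f x) (f y) > 2 * \<epsilon>"
  obtains t z where "0 \<le> t" and "t \<le> 1" and "z = (1 - t) *\<^sub>R x + t *\<^sub>R y"
    and "z \<in> slice_derivation f \<epsilon> D"
    and "dist (f x) (f z) > \<epsilon>" and "dist (f y) (f z) > \<epsilon>"
proof -
  define \<gamma> where "\<gamma> t = (1 - t) *\<^sub>R x + t *\<^sub>R y" for t
  have \<gamma>D: "\<gamma> t \<in> D" if "0 \<le> t" "t \<le> 1" for t
    unfolding \<gamma>_def using D(1) xy that by (intro convexD) auto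
  have "continuous_on {0..1} (\<lambda>t. dist (f x) (f (\<gamma> t)))"
    by (intro continuous_intros continuous_on_compose2[OF D(2)])
      (use \<gamma>D in \<open>auto simp: \<gamma>_def intro!: continuous_intros\<close>)
  then obtain t where t: "0 \<le> t" "t \<le> 1" and half: "dist (f x) (f (\<gamma> t)) = dist (f x) (f y) / 2"
    using IVT'[of "\<lambda>t. dist (f x) (f (\<gamma> t))" 0 "dist (f x) (f y) / 2" 1] by (auto simp: \<gamma>_def)
  have near: "dist (f x) (f (\<gamma> t)) > \<epsilon>" "dist (f y) (f (\<gamma> t)) > \<epsilon>"
    using half far dist_triangle[of "f x" "f y" "f (\<gamma> t)"] by (auto simp: dist_commute)
  have "diam_greater (f ` (D \<inter> H)) \<epsilon>" if H: "H \<in> open_halfspaces" "\<gamma> t \<in> H" for H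
    unfolding diam_greater_def
  proof
    assume bdd: "bounded (f ` (D \<inter> H))"
    obtain \<phi> :: "'a \<Rightarrow> real" and a where \<phi>: "bounded_linear \<phi>" and Ha: "H = {x. \<phi> x > a}"
      using H by (auto simp: open_halfspaces_def)
    have "\<phi> (\<gamma> t) = (1 - t) * \<phi> x + t * \<phi> y"
      using \<phi> by (simp add: \<gamma>_def linear_simps)
    moreover have "(1 - t) * \<phi> x + t * \<phi> y \<le> a" if "\<phi> x \<le> a" "\<phi> y \<le> a"
      using that t by (intro convex_bound_le) auto
    ultimately obtain w where w: "w \<in> {x, y}" "w \<in> H"
      using H(2) Ha by fastforce
    have "dist (f w) (f (\<gamma> t)) \<le> diameter (f ` (D \<inter> H))"
      using w xy H(2) \<gamma>D[OF t] by (intro diameter_bounded_bound[OF bdd]) auto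
    then show "\<epsilon> < diameter (f ` (D \<inter> H))"
      using w near by auto
  qed
  then have "\<gamma> t \<in> slice_derivation f \<epsilon> D"
    using \<gamma>D[OF t] by (auto simp: slice_derivation_def)
  then show ?thesis
    using that[OF t, of "\<gamma> t"] near by (simp add: \<gamma>_def)
qed

text \<open>For \<open>t \<le> 1/2\<close> the midpoint lies between the dividing point and
  \<open>y\<close>; convexity on that shorter segment compares the gaps. The other case swaps
  \<open>x\<close> and \<open>y\<close>.\<close>

lemma convex_gap_le_midpoint_gap:
  fixes h :: "'a::real_normed_vector \<Rightarrow> real"
  assumes h: "convex_on UNIV h" and t: "0 \<le> t" "t \<le> 1"
  shows "(1 - t) * h x + t * h y - h ((1 - t) *\<^sub>R x + t *\<^sub>R y)
    \<le> 2 * (h x / 2 + h y / 2 - h (midpoint x y))"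
proof -
  have *: "(1 - t) * h x + t * h y - h ((1 - t) *\<^sub>R x + t *\<^sub>R y)
      \<le> 2 * (h x / 2 + h y / 2 - h (midpoint x y))" if t: "0 \<le> t" "t \<le> 1/2" for t x y
  proof -
    define z where "z = (1 - t) *\<^sub>R x + t *\<^sub>R y"
    \<comment> \<open>The weight expressing the midpoint as
      \<open>l *\<^sub>R z + (1 - l) *\<^sub>R y\<close>; the bound \<open>l \<ge> 1/2\<close> is
      the source of the factor 2.\<close>
    define l where "l = 1 / (2 * (1 - t))"
    have l: "1/2 \<le> l" "l \<le> 1" and lt: "l * (1 - t) = 1/2"
      using t by (auto simp: l_def field_simps)
    have z: "h z \<le> (1 - t) * h x + t * h y"
      using h t by (auto simp: convex_on_def z_def)
    have "midpoint x y = l *\<^sub>R z + (1 - l) *\<^sub>R y"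
    proof -
      have "l *\<^sub>R z + (1 - l) *\<^sub>R y = (l * (1 - t)) *\<^sub>R x + (1 - l * (1 - t)) *\<^sub>R y"
        by (simp add: z_def algebra_simps)
      then show ?thesis
        unfolding lt by (simp add: midpoint_def scaleR_add_right inverse_eq_divide)
    qed
    then have "h (midpoint x y) \<le> l * h z + (1 - l) * h y"
      using h l by (auto simp: convex_on_def)
    moreover have "l * ((1 - t) * h x + t * h y - h z) = (l * (1 - t)) * h x + (l - l * (1 - t)) * h y - l * h z"
      by (simp add: algebra_simps)
    ultimately have "l * ((1 - t) * h x + t * h y - h z) \<le> h x / 2 + h y / 2 - h (midpoint x y)"
      unfolding lt by (simp add: algebra_simps)
    moreover have "1/2 * ((1 - t) * h x + t * h y - h z) \<le> l * ((1 - t) * h x + t * h y - h z)"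
      using l z by (intro mult_right_mono) auto
    ultimately show ?thesis by (simp add: z_def)
  qed
  show ?thesis
  proof (cases "t \<le> 1/2")
    case True
    then show ?thesis using *[of t x y] t by simp
  next
    case False
    then show ?thesis using *[of "1 - t" y x] t by (simp add: midpoint_sym add.commute)
  qed
qed

text \<open>The tolerances \<open>e n\<close> grow geometrically with \<open>n\<close>. At the last \<open>n\<close> for which \<open>x\<close> and \<open>y\<close>
  are both \<open>e n\<close>-close to the derived set \<open>D n\<close>, the segment between them comes \<open>e n\<close>-close to
  \<open>D (Suc n)\<close> away from its endpoints, whereas one endpoint has distance at least \<open>e (Suc n)\<close>.\<close>

lemma iterated_slice_derivation_gap:
  fixes C :: "'a::real_normed_vector set" and f :: "'a \<Rightarrow> 'm::metric_space"
  assumes C: "bounded C" "convex C" and f: "uniformly_continuous_on C f"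
    and \<epsilon>: "\<epsilon> > 0" and empty: "(slice_derivation f \<epsilon> ^^ N) C = {}"
  obtains \<delta> where "\<delta> > 0"
    and "\<And>x y. x \<in> C \<Longrightarrow> y \<in> C \<Longrightarrow> dist (f x) (f y) > 4 * \<epsilon> \<Longrightarrow>
      \<exists>n<N. (slice_derivation f \<epsilon> ^^ n) C \<noteq> {} \<and>
        \<delta> \<le> infdist x ((slice_derivation f \<epsilon> ^^ n) C) / 2 + infdist y ((slice_derivation f \<epsilon> ^^ n) C) / 2
          - infdist (midpoint x y) ((slice_derivation f \<epsilon> ^^ n) C)"
proof -
  define D where "D n = (slice_derivation f \<epsilon> ^^ n) C" for n
  have D_0: "D 0 = C" and D_Suc: "D (Suc n) = slice_derivation f \<epsilon> (D n)" and D_N: "D N = {}" for n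
    using empty by (auto simp: D_def)
  have D: "convex (D n) \<and> D n \<subseteq> C" for n
  proof (induction n)
    case 0
    then show ?case using C by (simp add: D_0)
  next
    case (Suc n)
    then show ?case
      using convex_slice_derivation[of "D n"] by (auto simp: D_Suc slice_derivation_def)
  qed
  obtain \<omega> where \<omega>: "\<omega> > 0"
    "\<And>x y. x \<in> C \<Longrightarrow> y \<in> C \<Longrightarrow> dist x y < \<omega> \<Longrightarrow> dist (f x) (f y) < \<epsilon>"
    using f \<epsilon> unfolding uniformly_continuous_on_def by metis
  define L where "L = diameter C + \<omega>"
  have L: "L \<ge> \<omega>" "L > 0"
    using \<omega>(1) diameter_ge_0[OF C(1)] by (auto simp: L_def)
  have dist_L: "dist x y \<le> L" if "x \<in> C" "y \<in> C" for x y
    using diameter_bounded_bound[OF C(1) that] \<omega>(1) by (simp add: L_def)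
  define \<tau> where "\<tau> = \<omega> / L"
  have \<tau>: "0 < \<tau>" "\<tau> \<le> 1" using \<omega>(1) L by (auto simp: \<tau>_def)
  \<comment> \<open>The exponent counts down to \<open>e N = \<omega>\<close>, and the ratio gives
    \<open>4 * e n = \<tau> * e (Suc n)\<close> for \<open>n < N\<close>.\<close>
  define e where "e n = (\<tau> / 4) ^ (N - n) * \<omega>" for n
  have e_pos: "e n > 0" for n using \<tau> \<omega>(1) by (simp add: e_def)
  have e_le: "e n \<le> \<omega>" for n
    using \<tau> \<omega>(1) power_le_one[of "\<tau> / 4" "N - n"] by (simp add: e_def)
  have e_ge: "e 0 \<le> e n" for n
    using \<tau> \<omega>(1) by (auto simp: e_def intro!: power_decreasing)
  have e_Suc: "4 * e n = \<tau> * e (Suc n)" if "n < N" for n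
    using that by (simp add: e_def Suc_diff_Suc[symmetric])
  have "\<exists>n<N. D n \<noteq> {} \<and>
      e 0 \<le> infdist x (D n) / 2 + infdist y (D n) / 2 - infdist (midpoint x y) (D n)"
    if xy: "x \<in> C" "y \<in> C" and far: "dist (f x) (f y) > 4 * \<epsilon>" for x y
  proof -
    define Q where "Q n \<longleftrightarrow> D n \<noteq> {} \<and> infdist x (D n) < e n \<and> infdist y (D n) < e n" for n
    have "Q 0" using xy e_pos by (auto simp: Q_def D_0)
    moreover have "\<not> Q N" by (simp add: Q_def D_N)
    ultimately obtain n where n: "n < N" "Q n" "\<not> Q (Suc n)"
      by (metis dec_induct[of 0 N Q] le0)
    obtain x' where x': "x' \<in> D n" "dist x x' < e n"
      using n(2) infdist_less_dist[of x "D n" "e n"] by (auto simp: Q_def)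
    obtain y' where y': "y' \<in> D n" "dist y y' < e n"
      using n(2) infdist_less_dist[of y "D n" "e n"] by (auto simp: Q_def)
    have C': "x' \<in> C" "y' \<in> C" using x' y' D by auto
    \<comment> \<open>Replacing \<open>x\<close> and \<open>y\<close> by points of
      \<open>D n\<close> costs less than \<open>2 * \<epsilon>\<close> of the separation
      \<open>4 * \<epsilon>\<close>.\<close>
    have "dist (f x) (f x') < \<epsilon>" "dist (f y) (f y') < \<epsilon>"
      using \<omega>(2) xy C' x' y' e_le[of n] by auto
    then have "dist (f x') (f y') > 2 * \<epsilon>"
      using far dist_triangle[of "f x" "f y" "f x'"] dist_triangle[of "f x'" "f y" "f y'"]
      by (simp add: dist_commute)
    then obtain t z' where t: "0 \<le> t" "t \<le> 1" and z': "z' = (1 - t) *\<^sub>R x' + t *\<^sub>R y'" "z' \<in> D (Suc n)"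
      and far': "dist (f x') (f z') > \<epsilon>" "dist (f y') (f z') > \<epsilon>"
      using slice_derivation_segment[of "D n" f x' y' \<epsilon>] D[of n] x' y' f
      by (auto simp: D_Suc dest!: uniformly_continuous_imp_continuous intro: continuous_on_subset)
    have "z' \<in> C" using z' D by blast
    \<comment> \<open>By the choice of \<open>\<omega>\<close>, separated images force separated
      points; on a segment of length at most \<open>L\<close> this keeps \<open>t\<close> and
      \<open>1 - t\<close> above \<open>\<tau>\<close>.\<close>
    then have "dist x' z' \<ge> \<omega>" "dist y' z' \<ge> \<omega>"
      using far' \<omega>(2) C' by (meson not_less less_asym)+
    moreover have "dist x' z' = t * dist x' y'"
    proof -
      have "x' - z' = t *\<^sub>R (x' - y')" by (simp add: z' algebra_simps)
      then show ?thesis using t by (simp add: dist_norm)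
    qed
    moreover have "dist y' z' = (1 - t) * dist x' y'"
    proof -
      have "y' - z' = (1 - t) *\<^sub>R (y' - x')" by (simp add: z' algebra_simps)
      then show ?thesis using t by (simp add: dist_norm norm_minus_commute)
    qed
    ultimately have "\<omega> \<le> t * L" "\<omega> \<le> (1 - t) * L"
      using t mult_left_mono[OF dist_L[OF C'], of t] mult_left_mono[OF dist_L[OF C'], of "1 - t"]
      by auto
    then have \<tau>t: "\<tau> \<le> t" "\<tau> \<le> 1 - t"
      using L by (auto simp: \<tau>_def field_simps)
    define h where "h u = infdist u (D (Suc n))" for u
    have ne: "D (Suc n) \<noteq> {}" using z' by blast
    have h: "convex_on UNIV h"
      unfolding h_def using convex_on_infdist D ne by blast
    have h_nonneg: "0 \<le> h u" for u by (simp add: h_def infdist_nonneg)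
    define z where "z = (1 - t) *\<^sub>R x + t *\<^sub>R y"
    have "h z \<le> e n"
    proof -
      have "h z \<le> dist z z'"
        unfolding h_def using z'(2) by (rule infdist_le)
      also have "\<dots> \<le> (1 - t) * dist x x' + t * dist y y'"
        using dist_triangle_add[of "(1 - t) *\<^sub>R x" "t *\<^sub>R y" "(1 - t) *\<^sub>R x'" "t *\<^sub>R y'"] t
        by (simp add: z_def z'(1) dist_scaleR_scaleR)
      also have "\<dots> \<le> e n"
        using t x' y' by (intro convex_bound_le) auto
      finally show ?thesis .
    qed
    moreover have "\<tau> * e (Suc n) \<le> (1 - t) * h x + t * h y"
    proof -
      have "e (Suc n) \<le> h x \<or> e (Suc n) \<le> h y"
        using n(3) ne by (auto simp: Q_def h_def)
      then show ?thesis
      proof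
        assume "e (Suc n) \<le> h x"
        then have "\<tau> * e (Suc n) \<le> (1 - t) * h x"
          using \<tau>t \<tau> e_pos[of "Suc n"] by (intro mult_mono) auto
        then show ?thesis using t h_nonneg[of y] by (simp add: add_increasing2)
      next
        assume "e (Suc n) \<le> h y"
        then have "\<tau> * e (Suc n) \<le> t * h y"
          using \<tau>t \<tau> e_pos[of "Suc n"] by (intro mult_mono) auto
        then show ?thesis using t h_nonneg[of x] by (simp add: add_increasing)
      qed
    qed
    \<comment> \<open>The gap at parameter \<open>t\<close> is at least
      \<open>4 * e n - e n\<close>, and half of it still exceeds
      \<open>e n \<ge> e 0\<close>.\<close>
    ultimately have "e 0 \<le> h x / 2 + h y / 2 - h (midpoint x y)"
      using convex_gap_le_midpoint_gap[OF h t, of x y] e_Suc[OF n(1)] e_ge[of n] e_pos[of n]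
      by (simp add: z_def)
    \<comment> \<open>The index found is \<open>Suc n\<close>, not \<open>n\<close>; it differs from
      \<open>N\<close> because \<open>D (Suc n)\<close> contains \<open>z'\<close>.\<close>
    moreover have "Suc n < N"
      using n(1) ne D_N by (metis Suc_lessI)
    ultimately show ?thesis
      using ne by (auto simp: h_def)
  qed
  then show ?thesis
    using that[of "e 0"] e_pos by (simp add: D_def)
qed

lemma contractive_seminorm_norm: "contractive_seminorm norm"
  by (simp add: contractive_seminorm_def norm_triangle_ineq)

lemma contractive_seminorm_zero: "contractive_seminorm (\<lambda>_. 0)"
  by (simp add: contractive_seminorm_def)

lemma iterated_slice_derivation_seminorm:
  fixes C :: "'a::real_normed_vector set" and f :: "'a \<Rightarrow> 'm::metric_space"
  assumes C: "bounded C" "convex C" and f: "uniformly_continuous_on C f"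
    and \<epsilon>: "\<epsilon> > 0" and empty: "(slice_derivation f \<epsilon> ^^ N) C = {}"
  shows "\<exists>P \<eta>. contractive_seminorm P \<and> \<eta> > 0 \<and>
    (\<forall>x\<in>C. \<forall>y\<in>C. dist (f x) (f y) > 4 * \<epsilon> \<longrightarrow> \<eta> \<le> parallelogram_gap P x y)"
proof -
  define D where "D n = (slice_derivation f \<epsilon> ^^ n) C" for n
  have D: "convex (D n)" for n
    by (induction n) (use C in \<open>auto simp: D_def intro: convex_slice_derivation\<close>)
  obtain \<delta> where \<delta>: "\<delta> > 0"
    "\<And>x y. x \<in> C \<Longrightarrow> y \<in> C \<Longrightarrow> dist (f x) (f y) > 4 * \<epsilon> \<Longrightarrow>
      \<exists>n<N. D n \<noteq> {} \<and> \<delta> \<le> infdist x (D n) / 2 + infdist y (D n) / 2 - infdist (midpoint x y) (D n)"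
    using iterated_slice_derivation_gap[OF C f \<epsilon> empty] unfolding D_def by blast
  obtain R where R: "R > 0" "\<And>x. x \<in> C \<Longrightarrow> norm x \<le> R"
    using C(1) by (auto simp: bounded_pos)
  have "\<exists>p. contractive_seminorm (fst p) \<and> snd p > 0 \<and> (D n \<noteq> {} \<longrightarrow> (\<forall>x\<in>C. \<forall>y\<in>C.
      \<delta> \<le> infdist x (D n) / 2 + infdist y (D n) / 2 - infdist (midpoint x y) (D n) \<longrightarrow>
      snd p \<le> parallelogram_gap (fst p) x y))" for n
  proof (cases "D n = {}")
    case True
    then show ?thesis
      \<comment> \<open>A placeholder for empty derivations, so that the seminorms form a full
        sequence.\<close>
      using contractive_seminorm_zero by (intro exI[of _ "(\<lambda>_. 0, 1)"]) auto
  next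
    case False
    have "\<bar>infdist x (D n) - infdist y (D n)\<bar> \<le> norm (x - y)" for x y
      using infdist_triangle_abs[of x "D n" y] by (simp add: dist_norm)
    then obtain P \<eta> where "contractive_seminorm P" "\<eta> > 0"
      "\<And>x y. norm x \<le> R \<Longrightarrow> norm y \<le> R \<Longrightarrow>
        \<delta> \<le> infdist x (D n) / 2 + infdist y (D n) / 2 - infdist (midpoint x y) (D n) \<Longrightarrow>
        \<eta> \<le> parallelogram_gap P x y"
      by (rule convex_gap_seminorm[OF convex_on_infdist[OF D False] _ \<delta>(1) R(1)]) blast
    then show ?thesis
      using R(2) by (intro exI[of _ "(P, \<eta>)"]) simp
  qed
  then have "\<exists>p. \<forall>n. contractive_seminorm (fst (p n)) \<and> snd (p n) > 0 \<and> (D n \<noteq> {} \<longrightarrow> (\<forall>x\<in>C. \<forall>y\<in>C.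
      \<delta> \<le> infdist x (D n) / 2 + infdist y (D n) / 2 - infdist (midpoint x y) (D n) \<longrightarrow>
      snd (p n) \<le> parallelogram_gap (fst (p n)) x y))"
    by (intro choice allI)
  then obtain p where p: "\<And>n. contractive_seminorm (fst (p n))" "\<And>n. snd (p n) > 0"
    "\<And>n x y. D n \<noteq> {} \<Longrightarrow> x \<in> C \<Longrightarrow> y \<in> C \<Longrightarrow>
      \<delta> \<le> infdist x (D n) / 2 + infdist y (D n) / 2 - infdist (midpoint x y) (D n) \<Longrightarrow>
      snd (p n) \<le> parallelogram_gap (fst (p n)) x y"
    by blast
  obtain P where P: "contractive_seminorm P"
    "\<And>n x y. (1/2) ^ Suc n * parallelogram_gap (fst (p n)) x y \<le> parallelogram_gap P x y"
    by (rule contractive_seminorm_combine[of "\<lambda>n. fst (p n)", OF p(1)]) blast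
  \<comment> \<open>The entry 1 keeps the set nonempty when \<open>N = 0\<close>.\<close>
  define \<eta> where "\<eta> = Min (insert 1 ((\<lambda>n. (1/2) ^ Suc n * snd (p n)) ` {..<N}))"
  have "\<eta> > 0"
    using p(2) by (simp add: \<eta>_def)
  moreover have "\<eta> \<le> parallelogram_gap P x y"
    if xy: "x \<in> C" "y \<in> C" and far: "dist (f x) (f y) > 4 * \<epsilon>" for x y
  proof -
    obtain n where n: "n < N" "D n \<noteq> {}"
      "\<delta> \<le> infdist x (D n) / 2 + infdist y (D n) / 2 - infdist (midpoint x y) (D n)"
      using \<delta>(2)[OF xy far] by blast
    have "\<eta> \<le> (1/2) ^ Suc n * snd (p n)"
      unfolding \<eta>_def using n(1) by (intro Min_le) auto
    also have "\<dots> \<le> (1/2) ^ Suc n * parallelogram_gap (fst (p n)) x y"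
      using p(3)[OF n(2) xy n(3)] by (intro mult_left_mono) auto
    also have "\<dots> \<le> parallelogram_gap P x y"
      by (rule P(2))
    finally show ?thesis .
  qed
  ultimately show ?thesis
    using P(1) by blast
qed

lemma finitely_dentable_imp_gap_norm:
  fixes C :: "'a::real_normed_vector set" and f :: "'a \<Rightarrow> 'm::metric_space"
  assumes C: "bounded C" "convex C" and f: "uniformly_continuous_on C f"
    and dent: "finitely_dentable_map C f"
  obtains N where "equivalent_norm N"
    and "\<And>\<epsilon>. \<epsilon> > 0 \<Longrightarrow>
      \<exists>\<delta>>0. \<forall>x\<in>C. \<forall>y\<in>C. parallelogram_gap N x y < \<delta> \<longrightarrow> dist (f x) (f y) < \<epsilon>"
proof -
  \<comment> \<open>Here \<open>4 * \<epsilon> n\<close> is half of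
    \<open>inverse (real (Suc n))\<close>, which leaves room for a strict inequality.\<close>
  define \<epsilon> where "\<epsilon> n = inverse (real (Suc n)) / 8" for n
  have \<epsilon>: "\<epsilon> n > 0" for n by (simp add: \<epsilon>_def)
  have "\<exists>p. contractive_seminorm (fst p) \<and> snd p > 0 \<and>
      (\<forall>x\<in>C. \<forall>y\<in>C. dist (f x) (f y) > 4 * \<epsilon> n \<longrightarrow> snd p \<le> parallelogram_gap (fst p) x y)" for n
  proof -
    obtain k where "(slice_derivation f (\<epsilon> n) ^^ k) C = {}"
      using dent \<epsilon> unfolding finitely_dentable_map_def by blast
    from iterated_slice_derivation_seminorm[OF C f \<epsilon> this] show ?thesis by auto
  qed
  then have "\<exists>p. \<forall>n. contractive_seminorm (fst (p n)) \<and> snd (p n) > 0 \<and>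
      (\<forall>x\<in>C. \<forall>y\<in>C. dist (f x) (f y) > 4 * \<epsilon> n \<longrightarrow> snd (p n) \<le> parallelogram_gap (fst (p n)) x y)"
    by (intro choice allI)
  then obtain p where p: "\<And>n. contractive_seminorm (fst (p n))" "\<And>n. snd (p n) > 0"
    "\<And>n x y. x \<in> C \<Longrightarrow> y \<in> C \<Longrightarrow> dist (f x) (f y) > 4 * \<epsilon> n \<Longrightarrow>
      snd (p n) \<le> parallelogram_gap (fst (p n)) x y"
    by blast
  \<comment> \<open>The original norm at index 0 bounds \<open>N\<close> below by a multiple of
    \<open>norm\<close>. The other seminorms move up by one index, whence the exponent
    \<open>Suc (Suc n)\<close> further down.\<close>
  define q where "q n = (case n of 0 \<Rightarrow> norm | Suc k \<Rightarrow> fst (p k))" for n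
  have q: "contractive_seminorm (q n)" for n
    using p(1) contractive_seminorm_norm by (cases n) (auto simp: q_def)
  obtain N where N: "contractive_seminorm N"
    "\<And>n x. (1/2) ^ Suc n * (q n x)\<^sup>2 \<le> (N x)\<^sup>2"
    "\<And>n x y. (1/2) ^ Suc n * parallelogram_gap (q n) x y \<le> parallelogram_gap N x y"
    by (rule contractive_seminorm_combine[of q, OF q]) blast
  have N_ge: "1/2 * norm x \<le> N x" for x
  proof (rule power2_le_imp_le)
    have "(1/2 * norm x)\<^sup>2 = 1/4 * (norm x)\<^sup>2"
      by (simp add: power_mult_distrib power_divide)
    also have "\<dots> \<le> 1/2 * (norm x)\<^sup>2" by simp
    also have "\<dots> \<le> (N x)\<^sup>2"
      using N(2)[of 0 x] by (simp add: q_def)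
    finally show "(1/2 * norm x)\<^sup>2 \<le> (N x)\<^sup>2" .
  qed (rule contractive_seminorm_nonneg[OF N(1)])
  have "N x = 0 \<longleftrightarrow> x = 0" for x
    using N_ge[of x] contractive_seminorm_le[OF N(1), of x] by auto
  moreover have "\<exists>a>0. \<exists>b>0. \<forall>x. a * norm x \<le> N x \<and> N x \<le> b * norm x"
    using N_ge contractive_seminorm_le[OF N(1)]
    by (intro exI[of _ "1/2"] conjI exI[of _ 1]) auto
  ultimately have "equivalent_norm N"
    using contractive_seminorm_add[OF N(1)] contractive_seminorm_scale[OF N(1)]
    by (simp add: equivalent_norm_def)
  then show ?thesis
  proof (rule that)
    fix e :: real assume "e > 0"
    then obtain n where n: "inverse (real (Suc n)) < e"
      using reals_Archimedean by blast
    define \<delta> where "\<delta> = (1/2) ^ Suc (Suc n) * snd (p n)"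
    have "\<delta> > 0" using p(2) by (simp add: \<delta>_def)
    moreover have "dist (f x) (f y) < e"
      if xy: "x \<in> C" "y \<in> C" and gap: "parallelogram_gap N x y < \<delta>" for x y
    proof (rule ccontr)
      assume "\<not> ?thesis"
      moreover have "inverse (real (Suc n)) > 0" by simp
      ultimately have "dist (f x) (f y) > 4 * \<epsilon> n"
        using n unfolding \<epsilon>_def by linarith
      then have "\<delta> \<le> (1/2) ^ Suc (Suc n) * parallelogram_gap (q (Suc n)) x y"
        using p(3)[OF xy] by (simp add: \<delta>_def q_def)
      also have "\<dots> \<le> parallelogram_gap N x y" by (rule N(3))
      finally show False using gap by simp
    qed
    ultimately show "\<exists>\<delta>>0. \<forall>x\<in>C. \<forall>y\<in>C. parallelogram_gap N x y < \<delta> \<longrightarrow> dist (f x) (f y) < e"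
      by blast
  qed
qed

theorem proposition3p2:
  fixes C :: "'a::banach set" and f :: "'a \<Rightarrow> 'm::metric_space"
  assumes "bounded C" and "closed C" and "convex C"
    and "uniformly_continuous_on C f"
  shows "finitely_dentable_map C f \<longleftrightarrow>
    (\<exists>N :: 'a \<Rightarrow> real. equivalent_norm N \<and>
       (\<forall>x y :: nat \<Rightarrow> 'a. range x \<subseteq> C \<and> range y \<subseteq> C \<and>
          (\<lambda>n. 2 * (N (x n))\<^sup>2 + 2 * (N (y n))\<^sup>2 - (N (x n + y n))\<^sup>2) \<longlonglongrightarrow> 0 \<longrightarrow>
          (\<lambda>n. dist (f (x n)) (f (y n))) \<longlonglongrightarrow> 0))"
  unfolding parallelogram_gap_def[symmetric]
proof
  assume "finitely_dentable_map C f"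
  then obtain N where N: "equivalent_norm N"
    "\<And>\<epsilon>. \<epsilon> > 0 \<Longrightarrow>
      \<exists>\<delta>>0. \<forall>x\<in>C. \<forall>y\<in>C. parallelogram_gap N x y < \<delta> \<longrightarrow> dist (f x) (f y) < \<epsilon>"
    using finitely_dentable_imp_gap_norm[OF assms(1,3,4)] by blast
  have "(\<lambda>n. dist (f (x n)) (f (y n))) \<longlonglongrightarrow> 0"
    if xy: "range x \<subseteq> C" "range y \<subseteq> C" and lim: "(\<lambda>n. parallelogram_gap N (x n) (y n)) \<longlonglongrightarrow> 0"
    for x y :: "nat \<Rightarrow> 'a"
  proof (rule tendstoI)
    fix e :: real assume "e > 0"
    then obtain \<delta> where \<delta>: "\<delta> > 0"
      "\<forall>x\<in>C. \<forall>y\<in>C. parallelogram_gap N x y < \<delta> \<longrightarrow> dist (f x) (f y) < e"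
      using N(2) by blast
    have "\<forall>\<^sub>F n in sequentially. parallelogram_gap N (x n) (y n) < \<delta>"
      using lim \<delta>(1) by (rule order_tendstoD)
    then show "\<forall>\<^sub>F n in sequentially. dist (dist (f (x n)) (f (y n))) 0 < e"
    proof (rule eventually_mono)
      fix n assume "parallelogram_gap N (x n) (y n) < \<delta>"
      moreover have "x n \<in> C" "y n \<in> C" using xy by auto
      ultimately show "dist (dist (f (x n)) (f (y n))) 0 < e"
        using \<delta>(2) by simp
    qed
  qed
  with N(1) show "\<exists>N. equivalent_norm N \<and> (\<forall>x y. range x \<subseteq> C \<and> range y \<subseteq> C \<and>
      (\<lambda>n. parallelogram_gap N (x n) (y n)) \<longlonglongrightarrow> 0 \<longrightarrow> (\<lambda>n. dist (f (x n)) (f (y n))) \<longlonglongrightarrow> 0)"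
    by blast
next
  assume "\<exists>N. equivalent_norm N \<and> (\<forall>x y. range x \<subseteq> C \<and> range y \<subseteq> C \<and>
      (\<lambda>n. parallelogram_gap N (x n) (y n)) \<longlonglongrightarrow> 0 \<longrightarrow> (\<lambda>n. dist (f (x n)) (f (y n))) \<longlonglongrightarrow> 0)"
  then obtain N where N: "equivalent_norm N"
    and seq: "\<And>x y. range x \<subseteq> C \<Longrightarrow> range y \<subseteq> C \<Longrightarrow>
      (\<lambda>n. parallelogram_gap N (x n) (y n)) \<longlonglongrightarrow> 0 \<Longrightarrow> (\<lambda>n. dist (f (x n)) (f (y n))) \<longlonglongrightarrow> 0"
    by blast
  have "0 \<le> parallelogram_gap N x y" for x y
    using N equivalent_norm_ge_zero[OF N]
    by (intro parallelogram_gap_ge_zero) (auto simp: equivalent_norm_def)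
  then show "finitely_dentable_map C f"
    using sequential_gap_imp_modulus[of N C f] seq
    by (intro gap_modulus_imp_finitely_dentable[OF assms(1) N]) blast
qed

end
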